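(* Let $R$ be a commutative ring with unit, let $X$ be a set, let $F\subseteq R\langle X\rangle$ be a set of noncommutative polynomials and let $Q$ be a labelled quiver with labels in $X$. If a polynomial $f\in R\langle X\rangle$ is a $Q$-consequence of $F$, then for all consistent representations of the quiver $Q$ such that all realizations of all elements of $F$ are zero, all realizations of $f$ are zero.
   Context: $R\langle X\rangle$ is the free associative $R$-algebra on $X$ (coefficients commute with indeterminates); $\langle X\rangle$ is the set of monomials, i.e. words over $X$ including the empty word $1$; $\operatorname{supp}(f)$ is the set of monomials with nonzero coefficient in $f$. A labelled quiver with labels in $X$ is $Q=(V,E,X,s,t,l)$ with $V$ a set of vertices, $E$ a set of edges, source and target maps $s,t:E\to V$ and a label function $l:E\to X$ (not necessarily injective). A nonempty path is $p=e_n\cdots e_1$ with $s(e_{i+1})=t(e_i)$; $s(p)=s(e_1)$, $t(p)=t(e_n)$, $l(p)=l(e_n)\cdots l(e_1)\in\langle X\rangle$. For each vertex $v$ there is an empty path $\epsilon_v$ from $v$ to $v$ with $l(\epsilon_v)=1$. Signatures: for a monomial $m$, $\sigma(m)=\{(s(p),t(p)) \mid p \text{ a path in } Q \text{ with } l(p)=m\}\subseteq V\times V$; for a polynomial $f$, $\sigma(f)=\bigcap_{m\in\operatorname{supp}(f)}\sigma(m)$ (so $\sigma(0)=V\times V$). $f$ is compatible with $Q$ if $\sigma(f)\neq\emptyset$. A $Q$-consequence of $F\subseteq R\langle X\rangle$ is a polynomial $f\in R\langle X\rangle$, compatible with $Q$, such that there exist finitely many $g_i\in F$, $a_i,b_i\in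 R\langle X\rangle$, $1\le i\le n$, with $f=\sum_{i=1}^n a_ig_ib_i$ (the empty sum being $0$) and such that for every $(u,v)\in\sigma(f)$ and every $i$ there exist vertices $u_i,v_i$ with $(u,u_i)\in\sigma(b_i)$, $(u_i,v_i)\in\sigma(g_i)$ and $(v_i,v)\in\sigma(a_i)$. A representation of $Q$ is a pair $(\mathcal M,\varphi)$, where $\mathcal M=(\mathcal M_v)_{v\in V}$ is a family of $R$-modules and $\varphi$ assigns to each $e\in E$ an $R$-linear map $\varphi(e):\mathcal M_{s(e)}\to\mathcal M_{t(e)}$. It is consistent (with the labelling $l$) if for any two nonempty paths $p=e_n\cdots e_1$ and $q=d_n\cdots d_1$ in $Q$ with the same source and the same target, $l(p)=l(q)$ implies $\varphi(e_n)\cdots\varphi(e_1)=\varphi(d_n)\cdots\varphi(d_1)$ (composition of maps). Realizations: for $v,w\in V$ let $R\langle X\rangle_{v,w}=\{f\in R\langle X\rangle \mid (v,w)\in\sigma(f)\}$, a free $R$-module with basis the monomials $m$ with $(v,w)\in\sigma(m)$. Given a consistent representation, $\varphi_{v,w}:R\langle X\rangle_{v,w}\to\operatorname{Hom}_R(\mathcal M_v,\mathcal M_w)$ is the $R$-linear map with $\varphi_{v,w}(l(e_n\cdots e_1))=\varphi(e_n)\cdots\varphi(e_1)$ for all nonempty paths $e_n\cdots e_1$ from $v$ to $w$ and, if $v=w$, $\varphi_{v,v}(1)=\operatorname{id}_{\mathcal M_v}$. The realizations of $f$ with respect to the representation are the maps $\varphi_{v,w}(f)$ for $(v,w)\in\sigma(f)$.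 *)

theory Defs
  imports "HOL-Algebra.Module" "Graph_Theory.Arc_Walk"
begin

section \<open>The free associative algebra\<close>

text \<open>
  A polynomial is its coefficient function on words (lists) of indeterminates. Words outside
  \<open>lists X\<close> get coefficient zero, so that equality of functions is equality of polynomials.
\<close>

definition supp :: "('r, 'z) ring_scheme \<Rightarrow> ('x list \<Rightarrow> 'r) \<Rightarrow> 'x list set" where
  "supp R f = {m. f m \<noteq> \<zero>\<^bsub>R\<^esub>}"

definition monomial :: "('r, 'z) ring_scheme \<Rightarrow> 'x list \<Rightarrow> 'x list \<Rightarrow> 'r" where
  "monomial R m = (\<lambda>w. if w = m then \<one>\<^bsub>R\<^esub> else \<zero>\<^bsub>R\<^esub>)"

definition free_algebra ::
  "('r, 'z) ring_scheme \<Rightarrow> 'x set \<Rightarrow> ('r, 'x list \<Rightarrow> 'r) module" where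
  "free_algebra R X =
     \<lparr>carrier = {f. (\<forall>m. f m \<in> carrier R) \<and> finite (supp R f) \<and> supp R f \<subseteq> lists X},
      mult = (\<lambda>f g w. \<Oplus>\<^bsub>R\<^esub>s \<in> {s. fst s @ snd s = w}. f (fst s) \<otimes>\<^bsub>R\<^esub> g (snd s)),
      one = monomial R [],
      zero = (\<lambda>w. \<zero>\<^bsub>R\<^esub>),
      add = (\<lambda>f g w. f w \<oplus>\<^bsub>R\<^esub> g w),
      smult = (\<lambda>c f w. c \<otimes>\<^bsub>R\<^esub> f w)\<rparr>"


section \<open>Labelled quivers and signatures\<close>

text \<open>
  The quiver without its labels is a \<^typ>\<open>('v, 'e) pre_digraph\<close> (loops and parallel edges
  allowed, no finiteness); \<open>tail\<close> is the source map and \<open>head\<close> the target map.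
\<close>

definition labelled_quiver :: "('v, 'e) pre_digraph \<Rightarrow> 'x set \<Rightarrow> ('e \<Rightarrow> 'x) \<Rightarrow> bool" where
  "labelled_quiver Q X l \<longleftrightarrow> wf_digraph Q \<and> l \<in> arcs Q \<rightarrow> X"

text \<open>
  Paths are arc walks \<open>pre_digraph.awalk Q u p v\<close>. These list the edges in the order of
  traversal: the path \<open>e\<^sub>n \<cdots> e\<^sub>1\<close> is the list \<open>[e\<^sub>1, \<dots>, e\<^sub>n]\<close>, whereas its label is the word
  \<open>l(e\<^sub>n) \<cdots> l(e\<^sub>1)\<close>. The empty list is the empty path at each vertex.
\<close>

definition path_label :: "('e \<Rightarrow> 'x) \<Rightarrow> 'e list \<Rightarrow> 'x list" where
  "path_label l p = rev (map l p)"

definition mon_sig ::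
  "('v, 'e) pre_digraph \<Rightarrow> ('e \<Rightarrow> 'x) \<Rightarrow> 'x list \<Rightarrow> ('v \<times> 'v) set" where
  "mon_sig Q l m = {(u, v). \<exists>p. pre_digraph.awalk Q u p v \<and> path_label l p = m}"

definition signature ::
  "('r, 'z) ring_scheme \<Rightarrow> ('v, 'e) pre_digraph \<Rightarrow> ('e \<Rightarrow> 'x) \<Rightarrow> ('x list \<Rightarrow> 'r) \<Rightarrow> ('v \<times> 'v) set"
  where
  "signature R Q l f = (verts Q \<times> verts Q) \<inter> (\<Inter>m \<in> supp R f. mon_sig Q l m)"

definition compatible ::
  "('r, 'z) ring_scheme \<Rightarrow> ('v, 'e) pre_digraph \<Rightarrow> ('e \<Rightarrow> 'x) \<Rightarrow> ('x list \<Rightarrow> 'r) \<Rightarrow> bool" where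
  "compatible R Q l f \<longleftrightarrow> signature R Q l f \<noteq> {}"

definition Q_consequence ::
  "('r, 'z) ring_scheme \<Rightarrow> 'x set \<Rightarrow> ('v, 'e) pre_digraph \<Rightarrow> ('e \<Rightarrow> 'x) \<Rightarrow>
   ('x list \<Rightarrow> 'r) set \<Rightarrow> ('x list \<Rightarrow> 'r) \<Rightarrow> bool" where
  "Q_consequence R X Q l F f \<longleftrightarrow>
     f \<in> carrier (free_algebra R X) \<and> compatible R Q l f \<and>
     (\<exists>(n::nat) g a b.
        (\<forall>i\<in>{1..n}. g i \<in> F \<and> a i \<in> carrier (free_algebra R X) \<and>
                    b i \<in> carrier (free_algebra R X)) \<and>
        f = (\<Oplus>\<^bsub>free_algebra R X\<^esub>i\<in>{1..n}.
               a i \<otimes>\<^bsub>free_algebra R X\<^esub> g i \<otimes>\<^bsub>free_algebra R X\<^esub> b i) \<and>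
        (\<forall>(u, v) \<in> signature R Q l f. \<forall>i\<in>{1..n}.
           \<exists>u'\<in>verts Q. \<exists>v'\<in>verts Q.
             (u, u') \<in> signature R Q l (b i) \<and>
             (u', v') \<in> signature R Q l (g i) \<and>
             (v', v) \<in> signature R Q l (a i)))"


section \<open>Representations and realizations\<close>

definition linear_maps ::
  "('r, 'z) ring_scheme \<Rightarrow> ('r, 'm) module \<Rightarrow> ('r, 'm) module \<Rightarrow> ('m \<Rightarrow> 'm) set" where
  "linear_maps R M N =
     {h. h \<in> carrier M \<rightarrow> carrier N \<and>
         (\<forall>x\<in>carrier M. \<forall>y\<in>carrier M. h (x \<oplus>\<^bsub>M\<^esub> y) = h x \<oplus>\<^bsub>N\<^esub> h y) \<and>
         (\<forall>c\<in>carrier R. \<forall>x\<in>carrier M. h (c \<odot>\<^bsub>M\<^esub> x) = c \<odot>\<^bsub>N\<^esub> h x)}"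

definition representation ::
  "('r, 'z) ring_scheme \<Rightarrow> ('v, 'e) pre_digraph \<Rightarrow> ('v \<Rightarrow> ('r, 'm) module) \<Rightarrow>
   ('e \<Rightarrow> 'm \<Rightarrow> 'm) \<Rightarrow> bool" where
  "representation R Q M \<phi> \<longleftrightarrow>
     (\<forall>v\<in>verts Q. Module.module R (M v)) \<and>
     (\<forall>e\<in>arcs Q. \<phi> e \<in> linear_maps R (M (tail Q e)) (M (head Q e)))"

text \<open>
  For \<open>p = [e\<^sub>1, \<dots>, e\<^sub>n]\<close>, \<open>fold \<phi> p\<close> is \<open>\<phi>(e\<^sub>n) \<circ> \<cdots> \<circ> \<phi>(e\<^sub>1)\<close>. Maps out of \<open>M v\<close> matter only
  on \<open>carrier (M v)\<close>, so they are compared there.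
\<close>

definition consistent ::
  "('v, 'e) pre_digraph \<Rightarrow> ('e \<Rightarrow> 'x) \<Rightarrow> ('v \<Rightarrow> ('r, 'm) module) \<Rightarrow> ('e \<Rightarrow> 'm \<Rightarrow> 'm) \<Rightarrow> bool"
  where
  "consistent Q l M \<phi> \<longleftrightarrow>
     (\<forall>u v p q. pre_digraph.awalk Q u p v \<and> pre_digraph.awalk Q u q v \<and>
        p \<noteq> [] \<and> q \<noteq> [] \<and> path_label l p = path_label l q \<longrightarrow>
        (\<forall>x\<in>carrier (M u). fold \<phi> p x = fold \<phi> q x))"

text \<open>
  The image of a monomial \<open>m\<close> with \<open>(v, w) \<in> mon_sig Q l m\<close>: by consistency it does not depend
  on the chosen path (see \<open>mon_realization_path\<close> below).
\<close>

definition mon_realization ::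
  "('v, 'e) pre_digraph \<Rightarrow> ('e \<Rightarrow> 'x) \<Rightarrow> ('e \<Rightarrow> 'm \<Rightarrow> 'm) \<Rightarrow> 'v \<Rightarrow> 'v \<Rightarrow> 'x list \<Rightarrow> 'm \<Rightarrow> 'm" where
  "mon_realization Q l \<phi> v w m =
     fold \<phi> (SOME p. pre_digraph.awalk Q v p w \<and> path_label l p = m)"

text \<open>The linear extension of \<^const>\<open>mon_realization\<close> to the polynomials with \<open>(v, w)\<close> in their
  signature.\<close>

definition realization ::
  "('r, 'z) ring_scheme \<Rightarrow> ('v, 'e) pre_digraph \<Rightarrow> ('e \<Rightarrow> 'x) \<Rightarrow> ('v \<Rightarrow> ('r, 'm) module) \<Rightarrow>
   ('e \<Rightarrow> 'm \<Rightarrow> 'm) \<Rightarrow> 'v \<Rightarrow> 'v \<Rightarrow> ('x list \<Rightarrow> 'r) \<Rightarrow> 'm \<Rightarrow> 'm" where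
  "realization R Q l M \<phi> v w f x =
     (\<Oplus>\<^bsub>M w\<^esub>m \<in> supp R f. f m \<odot>\<^bsub>M w\<^esub> mon_realization Q l \<phi> v w m x)"

definition all_realizations_zero ::
  "('r, 'z) ring_scheme \<Rightarrow> ('v, 'e) pre_digraph \<Rightarrow> ('e \<Rightarrow> 'x) \<Rightarrow> ('v \<Rightarrow> ('r, 'm) module) \<Rightarrow>
   ('e \<Rightarrow> 'm \<Rightarrow> 'm) \<Rightarrow> ('x list \<Rightarrow> 'r) \<Rightarrow> bool" where
  "all_realizations_zero R Q l M \<phi> f \<longleftrightarrow>
     (\<forall>(v, w) \<in> signature R Q l f. \<forall>x\<in>carrier (M v). realization R Q l M \<phi> v w f x = \<zero>\<^bsub>M w\<^esub>)"


section \<open>Linearity of the realization map and its values on paths\<close>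

lemma fold_path_closed:
  assumes "wf_digraph Q" "representation R Q M \<phi>"
    and "pre_digraph.awalk Q v p w" "x \<in> carrier (M v)"
  shows "fold \<phi> p x \<in> carrier (M w)"
  using assms(3,4)
proof (induction p arbitrary: v x)
  case Nil
  then show ?case by (auto simp: pre_digraph.awalk_def pre_digraph.cas.simps)
next
  case (Cons e p)
  have e: "e \<in> arcs Q" "tail Q e = v" "pre_digraph.awalk Q (head Q e) p w"
    using Cons.prems assms(1)
    by (auto simp: pre_digraph.awalk_def pre_digraph.cas.simps wf_digraph.head_in_verts)
  have "\<phi> e x \<in> carrier (M (head Q e))"
    using assms(2) e Cons.prems(2) by (fastforce simp: representation_def linear_maps_def)
  then show ?case using Cons.IH e(3) by simp
qed

lemma mon_realization_path:
  assumes "consistent Q l M \<phi>" "pre_digraph.awalk Q v p w" "x \<in> carrier (M v)"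
  shows "mon_realization Q l \<phi> v w (path_label l p) x = fold \<phi> p x"
proof -
  define q where "q = (SOME q. pre_digraph.awalk Q v q w \<and> path_label l q = path_label l p)"
  have q: "pre_digraph.awalk Q v q w" "path_label l q = path_label l p"
    using someI[of "\<lambda>q. pre_digraph.awalk Q v q w \<and> path_label l q = path_label l p" p] assms(2)
    unfolding q_def by auto
  have "fold \<phi> q x = fold \<phi> p x"
  proof (cases "p = []")
    case True
    then show ?thesis using q(2) by (simp add: path_label_def)
  next
    case False
    then have "q \<noteq> []" using q(2) by (auto simp: path_label_def)
    then show ?thesis using False q assms unfolding consistent_def by blast
  qed
  then show ?thesis by (simp add: mon_realization_def q_def)
qed

lemma mon_realization_closed:
  assumes "wf_digraph Q" "representation R Q M \<phi>" "(v, w) \<in> mon_sig Q l m" "x \<in> carrier (M v)"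
  shows "mon_realization Q l \<phi> v w m x \<in> carrier (M w)"
proof -
  define q where "q = (SOME q. pre_digraph.awalk Q v q w \<and> path_label l q = m)"
  have "pre_digraph.awalk Q v q w"
    using assms(3) someI_ex[of "\<lambda>q. pre_digraph.awalk Q v q w \<and> path_label l q = m"]
    unfolding q_def mon_sig_def by auto
  from fold_path_closed[OF assms(1,2) this assms(4)] show ?thesis
    by (simp add: mon_realization_def q_def)
qed

lemma realization_superset:
  assumes "wf_digraph Q" "representation R Q M \<phi>" "f \<in> carrier (free_algebra R X)"
    and "v \<in> verts Q" "w \<in> verts Q" "x \<in> carrier (M v)"
    and "finite S" "supp R f \<subseteq> S" "\<And>m. m \<in> S \<Longrightarrow> (v, w) \<in> mon_sig Q l m"
  shows "realization R Q l M \<phi> v w f x =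
    (\<Oplus>\<^bsub>M w\<^esub>m \<in> S. f m \<odot>\<^bsub>M w\<^esub> mon_realization Q l \<phi> v w m x)"
proof -
  interpret N: Module.module R "M w" using assms(2,5) by (simp add: representation_def)
  have c: "mon_realization Q l \<phi> v w m x \<in> carrier (M w)" if "m \<in> S" for m
    using mon_realization_closed[OF assms(1,2) assms(9)[OF that] assms(6)] .
  have f: "f m \<in> carrier R" for m using assms(3) by (simp add: free_algebra_def)
  show ?thesis unfolding realization_def
    by (rule N.add.finprod_mono_neutral_cong_left) (use assms(7,8) c f in \<open>auto simp: supp_def\<close>)
qed

lemma realization_path:
  assumes "wf_digraph Q" "representation R Q M \<phi>" "consistent Q l M \<phi>"
    and "pre_digraph.awalk Q v p w" "x \<in> carrier (M v)" "cring R"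
  shows "realization R Q l M \<phi> v w (monomial R (path_label l p)) x = fold \<phi> p x"
proof -
  let ?m = "path_label l p"
  have vw: "v \<in> verts Q" "w \<in> verts Q"
    using wf_digraph.awalk_hd_in_verts[OF assms(1,4)] wf_digraph.awalk_last_in_verts[OF assms(1,4)] .
  interpret N: Module.module R "M w" using assms(2) vw by (simp add: representation_def)
  have c: "fold \<phi> p x \<in> carrier (M w)" using fold_path_closed[OF assms(1,2,4,5)] .
  have "monomial R ?m \<in> carrier (free_algebra R UNIV)"
    by (auto simp: free_algebra_def monomial_def supp_def)
  then have "realization R Q l M \<phi> v w (monomial R ?m) x =
    (\<Oplus>\<^bsub>M w\<^esub>m \<in> {?m}. monomial R ?m m \<odot>\<^bsub>M w\<^esub> mon_realization Q l \<phi> v w m x)"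
    by (rule realization_superset[OF assms(1,2)])
      (use vw assms in \<open>auto simp: monomial_def supp_def mon_sig_def\<close>)
  also have "\<dots> = fold \<phi> p x"
    using c by (simp add: monomial_def mon_realization_path[OF assms(3,4,5)])
  finally show ?thesis .
qed

lemma realization_add:
  assumes "wf_digraph Q" "representation R Q M \<phi>" "(v, w) \<in> signature R Q l f"
    and "(v, w) \<in> signature R Q l g" "x \<in> carrier (M v)"
    and "f \<in> carrier (free_algebra R X)" "g \<in> carrier (free_algebra R X)"
  shows "realization R Q l M \<phi> v w (f \<oplus>\<^bsub>free_algebra R X\<^esub> g) x =
    realization R Q l M \<phi> v w f x \<oplus>\<^bsub>M w\<^esub> realization R Q l M \<phi> v w g x"
proof -
  have vw: "v \<in> verts Q" "w \<in> verts Q" using assms(3) by (auto simp: signature_def)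
  interpret N: Module.module R "M w" using assms(2) vw by (simp add: representation_def)
  let ?S = "supp R f \<union> supp R g" and ?h = "f \<oplus>\<^bsub>free_algebra R X\<^esub> g"
  have S: "finite ?S" using assms(6,7) by (simp add: free_algebra_def)
  have sig: "(v, w) \<in> mon_sig Q l m" if "m \<in> ?S" for m
    using that assms(3,4) by (auto simp: signature_def)
  have sub: "supp R ?h \<subseteq> ?S" by (auto simp: free_algebra_def supp_def)
  then have h: "?h \<in> carrier (free_algebra R X)"
    using assms(6,7) finite_subset[OF sub S] subset_trans[OF sub, of "lists X"]
    by (simp add: free_algebra_def)
  have r: "realization R Q l M \<phi> v w h x =
    (\<Oplus>\<^bsub>M w\<^esub>m \<in> ?S. h m \<odot>\<^bsub>M w\<^esub> mon_realization Q l \<phi> v w m x)"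
    if "h \<in> carrier (free_algebra R X)" "supp R h \<subseteq> ?S" for h
    by (rule realization_superset[OF assms(1,2) that(1) vw assms(5) S that(2) sig])
  have c: "mon_realization Q l \<phi> v w m x \<in> carrier (M w)" if "m \<in> ?S" for m
    using mon_realization_closed[OF assms(1,2) sig[OF that] assms(5)] .
  have k: "f m \<in> carrier R" "g m \<in> carrier R" for m
    using assms(6,7) by (auto simp: free_algebra_def)
  have "realization R Q l M \<phi> v w ?h x =
    (\<Oplus>\<^bsub>M w\<^esub>m \<in> ?S. f m \<odot>\<^bsub>M w\<^esub> mon_realization Q l \<phi> v w m x
      \<oplus>\<^bsub>M w\<^esub> g m \<odot>\<^bsub>M w\<^esub> mon_realization Q l \<phi> v w m x)"
    unfolding r[OF h sub]
    by (intro N.add.finprod_cong') (use c k in \<open>auto simp: free_algebra_def N.smult_l_distr\<close>)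
  also have "\<dots> = realization R Q l M \<phi> v w f x \<oplus>\<^bsub>M w\<^esub> realization R Q l M \<phi> v w g x"
    unfolding r[OF assms(6) Un_upper1] r[OF assms(7) Un_upper2]
    by (rule N.add.finprod_multf) (use c k in auto)
  finally show ?thesis .
qed

lemma realization_smult:
  assumes "wf_digraph Q" "representation R Q M \<phi>" "(v, w) \<in> signature R Q l f"
    and "x \<in> carrier (M v)" "f \<in> carrier (free_algebra R X)" "c \<in> carrier R"
  shows "realization R Q l M \<phi> v w (c \<odot>\<^bsub>free_algebra R X\<^esub> f) x =
    c \<odot>\<^bsub>M w\<^esub> realization R Q l M \<phi> v w f x"
proof -
  have vw: "v \<in> verts Q" "w \<in> verts Q" using assms(3) by (auto simp: signature_def)
  interpret N: Module.module R "M w" using assms(2) vw by (simp add: representation_def)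
  let ?h = "c \<odot>\<^bsub>free_algebra R X\<^esub> f"
  have S: "finite (supp R f)" using assms(5) by (simp add: free_algebra_def)
  have sig: "(v, w) \<in> mon_sig Q l m" if "m \<in> supp R f" for m
    using that assms(3) by (auto simp: signature_def)
  have sub: "supp R ?h \<subseteq> supp R f" using assms(6) by (auto simp: free_algebra_def supp_def)
  then have h: "?h \<in> carrier (free_algebra R X)"
    using assms(5,6) finite_subset[OF sub S] subset_trans[OF sub, of "lists X"]
    by (simp add: free_algebra_def)
  have k: "mon_realization Q l \<phi> v w m x \<in> carrier (M w)" if "m \<in> supp R f" for m
    using mon_realization_closed[OF assms(1,2) sig[OF that] assms(4)] .
  have f: "f m \<in> carrier R" for m using assms(5) by (auto simp: free_algebra_def)
  have "realization R Q l M \<phi> v w ?h x =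
    (\<Oplus>\<^bsub>M w\<^esub>m \<in> supp R f. c \<odot>\<^bsub>M w\<^esub> (f m \<odot>\<^bsub>M w\<^esub> mon_realization Q l \<phi> v w m x))"
    by (subst realization_superset[OF assms(1,2) h vw assms(4) S sub sig], assumption,
        intro N.add.finprod_cong')
      (use k f assms(6) in \<open>auto simp: free_algebra_def N.smult_assoc1\<close>)
  also have "\<dots> = c \<odot>\<^bsub>M w\<^esub> realization R Q l M \<phi> v w f x"
    unfolding realization_def
    by (rule N.finsum_smult_ldistr[symmetric]) (use S k f assms(6) in auto)
  finally show ?thesis .
qed

end

(*  Realization turns products into compositions: if (u, w) is in the signature of b and (w, v) in
    that of a, then (u, v) is in the signature of a b and the realization of a b at (u, v) is that
    of a at (w, v) after that of b at (u, w). So, at every pair in the signature of f, the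
    realization of each a_i g_i b_i factors through a realization of g_i, which vanishes, and
    realizations are additive. The last condition in the definition of a Q-consequence ensures
    that all these realizations exist.  *)

theory Submission
  imports Defs
begin

section \<open>Rearranging finite sums\<close>

text \<open>The fibres of h partition P, and a point of S outside the image of h contributes an
  empty sum. It is applied below to pairs of words grouped by their concatenation.\<close>

lemma (in abelian_monoid) finsum_fibres:
  assumes "finite P" "h ` P \<subseteq> S" "finite S" "\<And>p. p \<in> P \<Longrightarrow> g p \<in> carrier G"
  shows "(\<Oplus>p\<in>P. g p) = (\<Oplus>m\<in>S. \<Oplus>p\<in>{p \<in> P. h p = m}. g p)"
proof -
  have "P = (\<Union>m\<in>S. {p \<in> P. h p = m})" using assms(2) by auto
  then have "finsum G g P = finsum G g (\<Union>m\<in>S. {p \<in> P. h p = m})" by (rule arg_cong)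
  also have "\<dots> = (\<Oplus>m\<in>S. finsum G g {p \<in> P. h p = m})"
    by (rule add.finprod_UN_disjoint) (use assms in \<open>auto simp: pairwise_def disjnt_def\<close>)
  finally show ?thesis .
qed

text \<open>The fibre of \<open>fst\<close> over s is a copy of B, so this is
  \<open>finsum_fibres\<close> followed by reindexing along the injection
  \<open>Pair s\<close>.\<close>

lemma (in abelian_monoid) finsum_cartesian_product:
  assumes "finite A" "finite B" "\<And>s t. s \<in> A \<Longrightarrow> t \<in> B \<Longrightarrow> g (s, t) \<in> carrier G"
  shows "(\<Oplus>p\<in>A \<times> B. g p) = (\<Oplus>s\<in>A. \<Oplus>t\<in>B. g (s, t))"
proof -
  have "(\<Oplus>p\<in>A \<times> B. g p) = (\<Oplus>s\<in>A. \<Oplus>p\<in>{p \<in> A \<times> B. fst p = s}. g p)"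
    by (rule finsum_fibres) (use assms in auto)
  also have "\<dots> = (\<Oplus>s\<in>A. \<Oplus>t\<in>B. g (s, t))"
  proof (rule finsum_cong')
    fix s assume s: "s \<in> A"
    have "{p \<in> A \<times> B. fst p = s} = Pair s ` B" using s by auto
    moreover have "finsum G g (Pair s ` B) = (\<Oplus>t\<in>B. g (s, t))"
      by (rule finsum_reindex) (use assms s in \<open>auto simp: inj_on_def\<close>)
    ultimately show "(\<Oplus>p\<in>{p \<in> A \<times> B. fst p = s}. g p) = (\<Oplus>t\<in>B. g (s, t))" by simp
  qed (use assms in \<open>auto intro!: finsum_closed\<close>)
  finally show ?thesis .
qed

text \<open>Needed because a coefficient of a product of polynomials is itself a sum in R.\<close>

lemma (in Module.module) finsum_smult_rdistr:
  assumes "finite A" "c \<in> A \<rightarrow> carrier R" "x \<in> carrier M"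
  shows "(\<Oplus>\<^bsub>R\<^esub>i\<in>A. c i) \<odot>\<^bsub>M\<^esub> x = (\<Oplus>\<^bsub>M\<^esub>i\<in>A. c i \<odot>\<^bsub>M\<^esub> x)"
  using assms by (induction A rule: finite_induct) (simp_all add: Pi_def smult_l_distr)


section \<open>Linear maps\<close>

lemma linear_maps_zero:
  assumes "Module.module R M" "Module.module R N" "h \<in> linear_maps R M N"
  shows "h \<zero>\<^bsub>M\<^esub> = \<zero>\<^bsub>N\<^esub>"
proof -
  interpret M: Module.module R M by fact
  interpret N: Module.module R N by fact
  \<comment> \<open>\<open>linear_maps\<close> speaks of sums and scalar multiples only, so zero is
    written as a scalar multiple. The null laws are switched off to keep that product intact until
    homogeneity has been applied.\<close>
  have "h (\<zero>\<^bsub>R\<^esub> \<odot>\<^bsub>M\<^esub> \<zero>\<^bsub>M\<^esub>) = \<zero>\<^bsub>R\<^esub> \<odot>\<^bsub>N\<^esub> h \<zero>\<^bsub>M\<^esub>" "h \<zero>\<^bsub>M\<^esub> \<in> carrier N"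
    using assms(3) by (auto simp: linear_maps_def simp del: M.smult_l_null M.smult_r_null)
  then show ?thesis by simp
qed

lemma linear_maps_finsum:
  assumes "Module.module R M" "Module.module R N" "h \<in> linear_maps R M N"
    and "finite A" "g \<in> A \<rightarrow> carrier M"
  shows "h (\<Oplus>\<^bsub>M\<^esub>i\<in>A. g i) = (\<Oplus>\<^bsub>N\<^esub>i\<in>A. h (g i))"
proof -
  interpret M: Module.module R M by fact
  interpret N: Module.module R N by fact
  have h: "h \<in> carrier M \<rightarrow> carrier N"
    "\<And>x y. x \<in> carrier M \<Longrightarrow> y \<in> carrier M \<Longrightarrow> h (x \<oplus>\<^bsub>M\<^esub> y) = h x \<oplus>\<^bsub>N\<^esub> h y"
    using assms(3) by (auto simp: linear_maps_def)
  show ?thesis using assms(4,5)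
  proof (induction A rule: finite_induct)
    case (insert i A)
    then have g: "g \<in> A \<rightarrow> carrier M" "g i \<in> carrier M" by auto
    then have "(\<lambda>j. h (g j)) \<in> A \<rightarrow> carrier N" "h (g i) \<in> carrier N" using h(1) by auto
    then show ?case using insert g by (simp add: h(2))
  qed (simp add: linear_maps_zero[OF assms(1-3)])
qed

lemma fold_path_linear:
  assumes "wf_digraph Q" "representation R Q M \<phi>" "pre_digraph.awalk Q v p w"
  shows "fold \<phi> p \<in> linear_maps R (M v) (M w)"
  using assms(3)
proof (induction p arbitrary: v)
  case Nil
  then show ?case by (auto simp: pre_digraph.awalk_def pre_digraph.cas.simps linear_maps_def)
next
  case (Cons e p)
  have e: "e \<in> arcs Q" "tail Q e = v" "pre_digraph.awalk Q (head Q e) p w"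
    using Cons.prems assms(1)
    by (auto simp: pre_digraph.awalk_def pre_digraph.cas.simps wf_digraph.head_in_verts)
  have "\<phi> e \<in> linear_maps R (M v) (M (head Q e))"
    using assms(2) e by (auto simp: representation_def)
  then show ?case using Cons.IH[OF e(3)] by (auto simp: linear_maps_def Pi_iff)
qed

text \<open>Membership in \<open>mon_sig\<close> makes the path chosen by \<open>SOME\<close> a
  genuine path from v to w, so the realization is a composite of edge maps.\<close>

lemma mon_realization_linear:
  assumes "wf_digraph Q" "representation R Q M \<phi>" "(v, w) \<in> mon_sig Q l m"
  shows "mon_realization Q l \<phi> v w m \<in> linear_maps R (M v) (M w)"
proof -
  have "pre_digraph.awalk Q v (SOME q. pre_digraph.awalk Q v q w \<and> path_label l q = m) w"
    using assms(3) someI_ex[of "\<lambda>q. pre_digraph.awalk Q v q w \<and> path_label l q = m"]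
    by (auto simp: mon_sig_def)
  from fold_path_linear[OF assms(1,2) this] show ?thesis by (simp add: mon_realization_def)
qed


section \<open>Products of monomials\<close>

text \<open>Labels are read against the direction of travel: the path labelled t is traversed first,
  yet t becomes the right-hand factor of the word.\<close>

lemma mon_sig_append:
  assumes "wf_digraph Q" "(u, w) \<in> mon_sig Q l t" "(w, v) \<in> mon_sig Q l s"
  shows "(u, v) \<in> mon_sig Q l (s @ t)"
proof -
  interpret wf_digraph Q by fact
  obtain p q where "awalk u p w" "path_label l p = t" "awalk w q v" "path_label l q = s"
    using assms(2,3) by (auto simp: mon_sig_def)
  then have "awalk u (p @ q) v" "path_label l (p @ q) = s @ t"
    by (auto simp: path_label_def intro: awalk_appendI)
  then show ?thesis unfolding mon_sig_def by blast
qed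

text \<open>Consistency enters here. The path chosen for s @ t need not be the concatenation of
  those chosen for t and s, but by \<open>mon_realization_path\<close> each choice may be replaced
  by a convenient path: p for t, q for s and p @ q for the product.\<close>

lemma mon_realization_append:
  assumes "wf_digraph Q" "representation R Q M \<phi>" "consistent Q l M \<phi>"
    and "(u, w) \<in> mon_sig Q l t" "(w, v) \<in> mon_sig Q l s" "x \<in> carrier (M u)"
  shows "mon_realization Q l \<phi> u v (s @ t) x =
    mon_realization Q l \<phi> w v s (mon_realization Q l \<phi> u w t x)"
proof -
  interpret wf_digraph Q by fact
  obtain p q where pq: "awalk u p w" "path_label l p = t" "awalk w q v" "path_label l q = s"
    using assms(4,5) by (auto simp: mon_sig_def)
  then have pq': "awalk u (p @ q) v" "path_label l (p @ q) = s @ t"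
    by (auto simp: path_label_def intro: awalk_appendI)
  have "mon_realization Q l \<phi> u v (s @ t) x = fold \<phi> q (fold \<phi> p x)"
    using mon_realization_path[OF assms(3) pq'(1) assms(6)] pq'(2) by simp
  moreover have "mon_realization Q l \<phi> u w t x = fold \<phi> p x"
    using mon_realization_path[OF assms(3) pq(1) assms(6)] pq(2) by simp
  moreover have "mon_realization Q l \<phi> w v s (fold \<phi> p x) = fold \<phi> q (fold \<phi> p x)"
    using mon_realization_path[OF assms(3) pq(3)] fold_path_closed[OF assms(1,2) pq(1) assms(6)] pq(4)
    by simp
  ultimately show ?thesis by simp
qed


section \<open>Arithmetic of the free algebra\<close>

lemma free_algebra_add_closed:
  assumes "cring R" "f \<in> carrier (free_algebra R X)" "g \<in> carrier (free_algebra R X)"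
  shows "f \<oplus>\<^bsub>free_algebra R X\<^esub> g \<in> carrier (free_algebra R X)"
proof -
  interpret cring R by fact
  have sub: "supp R (\<lambda>m. f m \<oplus>\<^bsub>R\<^esub> g m) \<subseteq> supp R f \<union> supp R g" by (auto simp: supp_def)
  have "finite (supp R f \<union> supp R g)" using assms by (simp add: free_algebra_def)
  from finite_subset[OF sub this] subset_trans[OF sub, of "lists X"] assms show ?thesis
    by (simp add: free_algebra_def)
qed

text \<open>Makes the laws of \<open>finsum\<close> available in the free algebra, so that the sum
  in \<open>Q_consequence\<close> can be unfolded one summand at a time.\<close>

lemma abelian_monoid_free_algebra:
  assumes "cring R"
  shows "abelian_monoid (free_algebra R X)"
proof -
  interpret cring R by fact
  show ?thesis
  proof (rule abelian_monoidI)
    fix f g assume "f \<in> carrier (free_algebra R X)" "g \<in> carrier (free_algebra R X)"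
    then show "f \<oplus>\<^bsub>free_algebra R X\<^esub> g \<in> carrier (free_algebra R X)"
      by (rule free_algebra_add_closed[OF assms])
  qed (auto simp: free_algebra_def supp_def a_assoc intro: a_comm)
qed

text \<open>A splitting of w is determined by the length of its first factor. Finiteness matters
  because \<open>finsum\<close> over an infinite index set is zero by convention.\<close>

lemma finite_splittings: "finite {s :: 'x list \<times> 'x list. fst s @ snd s = w}"
proof (rule finite_subset)
  show "{s. fst s @ snd s = w} \<subseteq> (\<lambda>k. (take k w, drop k w)) ` {..length w}"
  proof
    fix s :: "'x list \<times> 'x list"
    assume "s \<in> {s. fst s @ snd s = w}"
    then have "s = (take (length (fst s)) w, drop (length (fst s)) w)" "length (fst s) \<le> length w"
      by (auto simp: prod_eq_iff)
    then show "s \<in> (\<lambda>k. (take k w, drop k w)) ` {..length w}" by blast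
  qed
qed simp

text \<open>The discarded splittings have a factor with coefficient zero. What remains is a fibre of
  concatenation on the finite set \<open>supp R a \<times> supp R b\<close>, the shape that
  \<open>finsum_fibres\<close> handles.\<close>

lemma free_algebra_mult_eq:
  assumes "cring R" "a \<in> carrier (free_algebra R X)" "b \<in> carrier (free_algebra R X)"
  shows "(a \<otimes>\<^bsub>free_algebra R X\<^esub> b) w =
    (\<Oplus>\<^bsub>R\<^esub>s \<in> {s \<in> supp R a \<times> supp R b. fst s @ snd s = w}. a (fst s) \<otimes>\<^bsub>R\<^esub> b (snd s))"
proof -
  interpret cring R by fact
  have "a m \<in> carrier R" "b m \<in> carrier R" for m using assms by (auto simp: free_algebra_def)
  then have "(\<Oplus>\<^bsub>R\<^esub>s \<in> {s. fst s @ snd s = w}. a (fst s) \<otimes>\<^bsub>R\<^esub> b (snd s)) =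
    (\<Oplus>\<^bsub>R\<^esub>s \<in> {s \<in> supp R a \<times> supp R b. fst s @ snd s = w}. a (fst s) \<otimes>\<^bsub>R\<^esub> b (snd s))"
    by (intro add.finprod_mono_neutral_cong_right) (auto simp: supp_def finite_splittings)
  then show ?thesis by (simp add: free_algebra_def)
qed

text \<open>A nonzero coefficient is a sum over a nonempty fibre. Cancellation and zero divisors can
  make the inclusion strict.\<close>

lemma supp_free_algebra_mult:
  assumes "cring R" "a \<in> carrier (free_algebra R X)" "b \<in> carrier (free_algebra R X)"
  shows "supp R (a \<otimes>\<^bsub>free_algebra R X\<^esub> b) \<subseteq> (\<lambda>s. fst s @ snd s) ` (supp R a \<times> supp R b)"
proof
  interpret cring R by fact
  fix w assume "w \<in> supp R (a \<otimes>\<^bsub>free_algebra R X\<^esub> b)"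
  then have "(\<Oplus>\<^bsub>R\<^esub>s \<in> {s \<in> supp R a \<times> supp R b. fst s @ snd s = w}. a (fst s) \<otimes>\<^bsub>R\<^esub> b (snd s)) \<noteq> \<zero>\<^bsub>R\<^esub>"
    unfolding free_algebra_mult_eq[OF assms, symmetric] by (simp add: supp_def)
  then have "{s \<in> supp R a \<times> supp R b. fst s @ snd s = w} \<noteq> {}"
    by (metis (no_types, lifting) finsum_empty)
  then show "w \<in> (\<lambda>s. fst s @ snd s) ` (supp R a \<times> supp R b)" by blast
qed

lemma free_algebra_mult_closed:
  assumes "cring R" "a \<in> carrier (free_algebra R X)" "b \<in> carrier (free_algebra R X)"
  shows "a \<otimes>\<^bsub>free_algebra R X\<^esub> b \<in> carrier (free_algebra R X)"
proof -
  interpret cring R by fact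
  let ?c = "a \<otimes>\<^bsub>free_algebra R X\<^esub> b"
  have ab: "a m \<in> carrier R" "b m \<in> carrier R" for m using assms by (auto simp: free_algebra_def)
  have "?c w \<in> carrier R" for w
    unfolding free_algebra_mult_eq[OF assms] by (rule finsum_closed) (use ab in auto)
  moreover have "finite (supp R ?c)"
    by (rule finite_subset[OF supp_free_algebra_mult[OF assms]])
      (use assms in \<open>auto simp: free_algebra_def\<close>)
  moreover have "supp R ?c \<subseteq> lists X"
  proof
    fix w assume "w \<in> supp R ?c"
    then obtain s t where "s \<in> supp R a" "t \<in> supp R b" "w = s @ t"
      using subsetD[OF supp_free_algebra_mult[OF assms]] by fastforce
    moreover have "supp R a \<subseteq> lists X" "supp R b \<subseteq> lists X"
      using assms by (auto simp: free_algebra_def)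
    ultimately show "w \<in> lists X" by auto
  qed
  ultimately show ?thesis by (auto simp: free_algebra_def)
qed


section \<open>Realizations of sums and products\<close>

lemma signature_zero: "signature R Q l \<zero>\<^bsub>free_algebra R X\<^esub> = verts Q \<times> verts Q"
  by (auto simp: signature_def supp_def free_algebra_def)

text \<open>Signatures grow as supports shrink, so cancellation in the sum does no harm.\<close>

lemma signature_add:
  assumes "cring R" "p \<in> signature R Q l f" "p \<in> signature R Q l g"
  shows "p \<in> signature R Q l (f \<oplus>\<^bsub>free_algebra R X\<^esub> g)"
proof -
  interpret cring R by fact
  have "supp R (f \<oplus>\<^bsub>free_algebra R X\<^esub> g) \<subseteq> supp R f \<union> supp R g"
    by (auto simp: supp_def free_algebra_def)
  then show ?thesis using assms(2,3) unfolding signature_def by blast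
qed

lemma signature_mult:
  assumes "cring R" "wf_digraph Q"
    and "a \<in> carrier (free_algebra R X)" "b \<in> carrier (free_algebra R X)"
    and "(u, w) \<in> signature R Q l b" "(w, v) \<in> signature R Q l a"
  shows "(u, v) \<in> signature R Q l (a \<otimes>\<^bsub>free_algebra R X\<^esub> b)"
proof -
  have "(u, v) \<in> mon_sig Q l m" if m: "m \<in> supp R (a \<otimes>\<^bsub>free_algebra R X\<^esub> b)" for m
  proof -
    obtain s t where st: "s \<in> supp R a" "t \<in> supp R b" "m = s @ t"
      using subsetD[OF supp_free_algebra_mult[OF assms(1,3,4)] m] by auto
    have "(u, w) \<in> mon_sig Q l t" "(w, v) \<in> mon_sig Q l s"
      using st assms(5,6) by (auto simp: signature_def)
    then show ?thesis unfolding st(3) by (rule mon_sig_append[OF assms(2)])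
  qed
  then show ?thesis using assms(5,6) by (auto simp: signature_def)
qed

lemma realization_closed:
  assumes "wf_digraph Q" "representation R Q M \<phi>" "(v, w) \<in> signature R Q l f"
    and "x \<in> carrier (M v)" "f \<in> carrier (free_algebra R X)"
  shows "realization R Q l M \<phi> v w f x \<in> carrier (M w)"
proof -
  interpret N: Module.module R "M w" using assms(2,3) by (auto simp: representation_def signature_def)
  have "mon_realization Q l \<phi> v w m x \<in> carrier (M w)" if "m \<in> supp R f" for m
    by (rule mon_realization_closed[OF assms(1,2) _ assms(4), where l = l])
      (use assms(3) that in \<open>auto simp: signature_def\<close>)
  moreover have "f m \<in> carrier R" for m using assms(5) by (simp add: free_algebra_def)
  ultimately show ?thesis unfolding realization_def by (intro N.finsum_closed) auto
qed

text \<open>Serves the outer factor of a product once the inner factor has produced zero.\<close>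

lemma realization_at_zero:
  assumes "wf_digraph Q" "representation R Q M \<phi>" "(v, w) \<in> signature R Q l f"
    and "f \<in> carrier (free_algebra R X)"
  shows "realization R Q l M \<phi> v w f \<zero>\<^bsub>M v\<^esub> = \<zero>\<^bsub>M w\<^esub>"
proof -
  have mod: "Module.module R (M v)" "Module.module R (M w)"
    using assms(2,3) by (auto simp: representation_def signature_def)
  interpret N: Module.module R "M w" by fact
  have "mon_realization Q l \<phi> v w m \<zero>\<^bsub>M v\<^esub> = \<zero>\<^bsub>M w\<^esub>" if "m \<in> supp R f" for m
    by (rule linear_maps_zero[OF mod mon_realization_linear[OF assms(1,2)]])
      (use assms(3) that in \<open>auto simp: signature_def\<close>)
  moreover have "f m \<in> carrier R" for m using assms(4) by (simp add: free_algebra_def)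
  ultimately show ?thesis unfolding realization_def by (intro N.add.finprod_one_eqI) auto
qed

text \<open>Both sides equal the sum over all s in supp(a) and t in supp(b) of a(s) b(t) times the
  realization of s after that of t. The left side reaches it by undoing the grouping by
  concatenation, the right side by linearity of the realizations of monomials.\<close>

lemma realization_mult:
  assumes "wf_digraph Q" "representation R Q M \<phi>" "consistent Q l M \<phi>"
    and "a \<in> carrier (free_algebra R X)" "b \<in> carrier (free_algebra R X)"
    and "(u, w) \<in> signature R Q l b" "(w, v) \<in> signature R Q l a" "x \<in> carrier (M u)"
  shows "realization R Q l M \<phi> u v (a \<otimes>\<^bsub>free_algebra R X\<^esub> b) x =
    realization R Q l M \<phi> w v a (realization R Q l M \<phi> u w b x)"
proof -
  have vs: "u \<in> verts Q" "v \<in> verts Q" "w \<in> verts Q" using assms(6,7) by (auto simp: signature_def)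
  then have mod: "Module.module R (M w)" "Module.module R (M v)"
    using assms(2) by (auto simp: representation_def)
  interpret N: Module.module R "M v" by fact
  interpret W: Module.module R "M w" by fact
  have R: "cring R" by (rule N.R.is_cring)
  let ?c = "a \<otimes>\<^bsub>free_algebra R X\<^esub> b" and ?A = "supp R a" and ?B = "supp R b"
  let ?cat = "\<lambda>s. fst s @ snd s"
  let ?S = "?cat ` (?A \<times> ?B)"
  let ?ra = "mon_realization Q l \<phi> w v" and ?rb = "mon_realization Q l \<phi> u w"
    and ?r = "mon_realization Q l \<phi> u v"
  have fin: "finite ?A" "finite ?B" using assms(4,5) by (auto simp: free_algebra_def)
  have ab: "a m \<in> carrier R" "b m \<in> carrier R" for m
    using assms(4,5) by (auto simp: free_algebra_def)
  have sig_a: "(w, v) \<in> mon_sig Q l s" if "s \<in> ?A" for s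
    using that assms(7) by (auto simp: signature_def)
  have sig_b: "(u, w) \<in> mon_sig Q l t" if "t \<in> ?B" for t
    using that assms(6) by (auto simp: signature_def)
  have sig: "(u, v) \<in> mon_sig Q l m" if "m \<in> ?S" for m
    using that mon_sig_append[OF assms(1) sig_b sig_a] by auto
  have lin: "?ra s \<in> linear_maps R (M w) (M v)" if "s \<in> ?A" for s
    by (rule mon_realization_linear[OF assms(1,2) sig_a[OF that]])
  have rb: "?rb t x \<in> carrier (M w)" if "t \<in> ?B" for t
    by (rule mon_realization_closed[OF assms(1,2) sig_b[OF that] assms(8)])
  have ra: "?ra s y \<in> carrier (M v)" if "s \<in> ?A" "y \<in> carrier (M w)" for s y
    by (rule mon_realization_closed[OF assms(1,2) sig_a[OF that(1)] that(2)])
  have r: "?r m x \<in> carrier (M v)" if "m \<in> ?S" for m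
    by (rule mon_realization_closed[OF assms(1,2) sig[OF that] assms(8)])
  \<comment> \<open>The contribution of a single pair of words, with the concatenated word still
    realized as a whole.\<close>
  define h where "h = (\<lambda>s. (a (fst s) \<otimes>\<^bsub>R\<^esub> b (snd s)) \<odot>\<^bsub>M v\<^esub> ?r (?cat s) x)"
  have h: "h s \<in> carrier (M v)" if "s \<in> ?A \<times> ?B" for s
    unfolding h_def using that ab r by (intro N.smult_closed N.R.m_closed) auto
  \<comment> \<open>Cancellation may leave the support of the product smaller than
    \<open>?S\<close>. Summing over all of \<open>?S\<close> is still legitimate, since each of its
    words labels a path from u to v.\<close>
  have "realization R Q l M \<phi> u v ?c x = (\<Oplus>\<^bsub>M v\<^esub>m \<in> ?S. ?c m \<odot>\<^bsub>M v\<^esub> ?r m x)"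
    by (rule realization_superset[OF assms(1,2) free_algebra_mult_closed[OF R assms(4,5)]])
      (use vs assms(8) fin sig supp_free_algebra_mult[OF R assms(4,5)] in auto)
  also have "\<dots> = (\<Oplus>\<^bsub>M v\<^esub>m \<in> ?S. \<Oplus>\<^bsub>M v\<^esub>s \<in> {s \<in> ?A \<times> ?B. ?cat s = m}. h s)"
  proof (rule N.finsum_cong'[OF refl])
    show "(\<lambda>m. \<Oplus>\<^bsub>M v\<^esub>s \<in> {s \<in> ?A \<times> ?B. ?cat s = m}. h s) \<in> ?S \<rightarrow> carrier (M v)"
      using h by (intro Pi_I N.finsum_closed) auto
    fix m assume m: "m \<in> ?S"
    have "?c m \<odot>\<^bsub>M v\<^esub> ?r m x =
      (\<Oplus>\<^bsub>M v\<^esub>s \<in> {s \<in> ?A \<times> ?B. ?cat s = m}. (a (fst s) \<otimes>\<^bsub>R\<^esub> b (snd s)) \<odot>\<^bsub>M v\<^esub> ?r m x)"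
      unfolding free_algebra_mult_eq[OF R assms(4,5)]
      by (rule N.finsum_smult_rdistr) (use fin ab r m in auto)
    also have "\<dots> = (\<Oplus>\<^bsub>M v\<^esub>s \<in> {s \<in> ?A \<times> ?B. ?cat s = m}. h s)"
      by (rule N.finsum_cong') (use h in \<open>auto simp: h_def\<close>)
    finally show "?c m \<odot>\<^bsub>M v\<^esub> ?r m x = (\<Oplus>\<^bsub>M v\<^esub>s \<in> {s \<in> ?A \<times> ?B. ?cat s = m}. h s)" .
  qed
  also have "\<dots> = (\<Oplus>\<^bsub>M v\<^esub>s \<in> ?A \<times> ?B. h s)"
    by (rule N.finsum_fibres[symmetric]) (use fin h in auto)
  also have "\<dots> = (\<Oplus>\<^bsub>M v\<^esub>s \<in> ?A. \<Oplus>\<^bsub>M v\<^esub>t \<in> ?B. h (s, t))"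
    by (rule N.finsum_cartesian_product) (use fin h in auto)
  \<comment> \<open>Now the realization of s @ t is split at w. For fixed s, the scalar a(s) and
    then the linear map of s are pulled out of the sum over t, which leaves the realization of
    b.\<close>
  also have "\<dots> = (\<Oplus>\<^bsub>M v\<^esub>s \<in> ?A. a s \<odot>\<^bsub>M v\<^esub> ?ra s (realization R Q l M \<phi> u w b x))"
  proof (rule N.finsum_cong'[OF refl])
    have "realization R Q l M \<phi> u w b x \<in> carrier (M w)"
      by (rule realization_closed[OF assms(1,2,6,8,5)])
    then show "(\<lambda>s. a s \<odot>\<^bsub>M v\<^esub> ?ra s (realization R Q l M \<phi> u w b x)) \<in> ?A \<rightarrow> carrier (M v)"
      using ra ab by auto
    fix s assume s: "s \<in> ?A"
    have smult: "?ra s (k \<odot>\<^bsub>M w\<^esub> y) = k \<odot>\<^bsub>M v\<^esub> ?ra s y" if "k \<in> carrier R" "y \<in> carrier (M w)" for k y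
      using lin[OF s] that by (simp add: linear_maps_def)
    have hst: "h (s, t) = a s \<odot>\<^bsub>M v\<^esub> ?ra s (b t \<odot>\<^bsub>M w\<^esub> ?rb t x)" if "t \<in> ?B" for t
      using mon_realization_append[OF assms(1-3) sig_b[OF that] sig_a[OF s] assms(8)] that s rb ra ab
      by (simp add: h_def smult N.smult_assoc1)
    have c: "?ra s (b t \<odot>\<^bsub>M w\<^esub> ?rb t x) \<in> carrier (M v)" if "t \<in> ?B" for t
      using that s rb ra ab by simp
    have "(\<Oplus>\<^bsub>M v\<^esub>t \<in> ?B. h (s, t)) =
      (\<Oplus>\<^bsub>M v\<^esub>t \<in> ?B. a s \<odot>\<^bsub>M v\<^esub> ?ra s (b t \<odot>\<^bsub>M w\<^esub> ?rb t x))"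
      by (rule N.finsum_cong') (use hst c ab in auto)
    also have "\<dots> = a s \<odot>\<^bsub>M v\<^esub> (\<Oplus>\<^bsub>M v\<^esub>t \<in> ?B. ?ra s (b t \<odot>\<^bsub>M w\<^esub> ?rb t x))"
      by (rule N.finsum_smult_ldistr[symmetric]) (use fin c ab in auto)
    also have "(\<Oplus>\<^bsub>M v\<^esub>t \<in> ?B. ?ra s (b t \<odot>\<^bsub>M w\<^esub> ?rb t x)) =
      ?ra s (realization R Q l M \<phi> u w b x)"
      unfolding realization_def
      by (rule linear_maps_finsum[OF mod lin[OF s], symmetric]) (use fin rb ab in auto)
    finally show "(\<Oplus>\<^bsub>M v\<^esub>t \<in> ?B. h (s, t)) = a s \<odot>\<^bsub>M v\<^esub> ?ra s (realization R Q l M \<phi> u w b x)" .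
  qed
  finally show ?thesis by (simp add: realization_def)
qed

text \<open>Both claims go through one induction: \<open>realization_add\<close> can be applied to a
  partial sum only once (u, v) is known to lie in its signature.\<close>

lemma realization_finsum:
  assumes "wf_digraph Q" "representation R Q M \<phi>" "cring R" "u \<in> verts Q" "v \<in> verts Q"
    and "x \<in> carrier (M u)" "finite I" "h \<in> I \<rightarrow> carrier (free_algebra R X)"
    and "\<And>i. i \<in> I \<Longrightarrow> (u, v) \<in> signature R Q l (h i)"
  shows "(u, v) \<in> signature R Q l (\<Oplus>\<^bsub>free_algebra R X\<^esub>i\<in>I. h i)"
    and "realization R Q l M \<phi> u v (\<Oplus>\<^bsub>free_algebra R X\<^esub>i\<in>I. h i) x =
      (\<Oplus>\<^bsub>M v\<^esub>i\<in>I. realization R Q l M \<phi> u v (h i) x)"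
proof -
  interpret A: abelian_monoid "free_algebra R X" by (rule abelian_monoid_free_algebra) fact
  interpret N: Module.module R "M v" using assms(2,5) by (simp add: representation_def)
  have "(u, v) \<in> signature R Q l (\<Oplus>\<^bsub>free_algebra R X\<^esub>i\<in>I. h i) \<and>
    realization R Q l M \<phi> u v (\<Oplus>\<^bsub>free_algebra R X\<^esub>i\<in>I. h i) x =
      (\<Oplus>\<^bsub>M v\<^esub>i\<in>I. realization R Q l M \<phi> u v (h i) x)"
    using assms(7-9)
  proof (induction I rule: finite_induct)
    \<comment> \<open>The zero polynomial has every pair of vertices in its signature, which is
      where the assumptions on u and v come in.\<close>
    case empty
    have "supp R \<zero>\<^bsub>free_algebra R X\<^esub> = {}" by (simp add: supp_def free_algebra_def)
    then show ?case using assms(4,5) by (simp add: signature_zero realization_def)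
  next
    case (insert i I)
    let ?s = "\<Oplus>\<^bsub>free_algebra R X\<^esub>i\<in>I. h i"
    have IH: "(u, v) \<in> signature R Q l ?s"
      "realization R Q l M \<phi> u v ?s x = (\<Oplus>\<^bsub>M v\<^esub>i\<in>I. realization R Q l M \<phi> u v (h i) x)"
      using insert.IH insert.prems by auto
    have i: "h i \<in> carrier (free_algebra R X)" "(u, v) \<in> signature R Q l (h i)"
      and s: "?s \<in> carrier (free_algebra R X)"
      using insert.prems by auto
    have c: "realization R Q l M \<phi> u v (h j) x \<in> carrier (M v)" if "j \<in> insert i I" for j
      by (rule realization_closed[OF assms(1,2) _ assms(6)]) (use insert.prems that in auto)
    have eq: "(\<Oplus>\<^bsub>free_algebra R X\<^esub>i\<in>insert i I. h i) = h i \<oplus>\<^bsub>free_algebra R X\<^esub> ?s"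
      using insert by (intro A.finsum_insert) auto
    have "realization R Q l M \<phi> u v (h i \<oplus>\<^bsub>free_algebra R X\<^esub> ?s) x =
      (\<Oplus>\<^bsub>M v\<^esub>i\<in>insert i I. realization R Q l M \<phi> u v (h i) x)"
      using realization_add[OF assms(1,2) i(2) IH(1) assms(6) i(1) s] IH(2) insert.hyps c by auto
    then show ?case using signature_add[OF assms(3) i(2) IH(1)] eq by simp
  qed
  then show "(u, v) \<in> signature R Q l (\<Oplus>\<^bsub>free_algebra R X\<^esub>i\<in>I. h i)"
    and "realization R Q l M \<phi> u v (\<Oplus>\<^bsub>free_algebra R X\<^esub>i\<in>I. h i) x =
      (\<Oplus>\<^bsub>M v\<^esub>i\<in>I. realization R Q l M \<phi> u v (h i) x)"
    by auto
qed

section \<open>Vanishing of the realizations of a Q-consequence\<close>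

theorem theorem2:
  fixes R :: "('r, 'z) ring_scheme"
    and X :: "'x set"
    and F :: "('x list \<Rightarrow> 'r) set"
    and Q :: "('v, 'e) pre_digraph"
    and l :: "'e \<Rightarrow> 'x"
    and f :: "'x list \<Rightarrow> 'r"
  assumes "cring R"
    and "labelled_quiver Q X l"
    and "F \<subseteq> carrier (free_algebra R X)"
    and "f \<in> carrier (free_algebra R X)"
    and "Q_consequence R X Q l F f"
  shows "\<forall>(M :: 'v \<Rightarrow> ('r, 'm) module) \<phi>.
           representation R Q M \<phi> \<and> consistent Q l M \<phi> \<and>
           (\<forall>g\<in>F. all_realizations_zero R Q l M \<phi> g) \<longrightarrow>
           all_realizations_zero R Q l M \<phi> f"
proof (intro allI impI)
  fix M :: "'v \<Rightarrow> ('r, 'm) module" and \<phi>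
  assume "representation R Q M \<phi> \<and> consistent Q l M \<phi> \<and>
    (\<forall>g\<in>F. all_realizations_zero R Q l M \<phi> g)"
  then have rep: "representation R Q M \<phi>" and con: "consistent Q l M \<phi>"
    and zero: "\<And>g. g \<in> F \<Longrightarrow> all_realizations_zero R Q l M \<phi> g"
    by auto
  have Q: "wf_digraph Q" using assms(2) by (simp add: labelled_quiver_def)
  let ?A = "free_algebra R X"
  obtain n :: nat and g a b where gab:
      "\<And>i. i \<in> {1..n} \<Longrightarrow> g i \<in> F \<and> a i \<in> carrier ?A \<and> b i \<in> carrier ?A"
    and f: "f = (\<Oplus>\<^bsub>?A\<^esub>i\<in>{1..n}. a i \<otimes>\<^bsub>?A\<^esub> g i \<otimes>\<^bsub>?A\<^esub> b i)"
    and sig: "\<forall>(u, v) \<in> signature R Q l f. \<forall>i\<in>{1..n}. \<exists>u'\<in>verts Q. \<exists>v'\<in>verts Q.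
      (u, u') \<in> signature R Q l (b i) \<and> (u', v') \<in> signature R Q l (g i) \<and>
      (v', v) \<in> signature R Q l (a i)"
    using assms(5) unfolding Q_consequence_def by blast
  have "realization R Q l M \<phi> u v f x = \<zero>\<^bsub>M v\<^esub>"
    if uv: "(u, v) \<in> signature R Q l f" and x: "x \<in> carrier (M u)" for u v x
  proof -
    have verts: "u \<in> verts Q" "v \<in> verts Q" using uv by (auto simp: signature_def)
    interpret N: Module.module R "M v" using rep verts by (simp add: representation_def)
    let ?h = "\<lambda>i. a i \<otimes>\<^bsub>?A\<^esub> g i \<otimes>\<^bsub>?A\<^esub> b i"
    have summand: "?h i \<in> carrier ?A \<and> (u, v) \<in> signature R Q l (?h i) \<and>
      realization R Q l M \<phi> u v (?h i) x = \<zero>\<^bsub>M v\<^esub>" if i: "i \<in> {1..n}" for i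
    proof -
      \<comment> \<open>The intermediate vertices may vary with the pair (u, v) and with i, so each
        summand is treated separately at a fixed pair.\<close>
      obtain u' v' where s: "(u, u') \<in> signature R Q l (b i)" "(u', v') \<in> signature R Q l (g i)"
          "(v', v) \<in> signature R Q l (a i)"
        using sig uv i by blast
      have c: "a i \<in> carrier ?A" "g i \<in> carrier ?A" "b i \<in> carrier ?A"
        using gab[OF i] assms(3) by auto
      \<comment> \<open>The triple product associates to the left, so b i is split off first, at u'.
        The product of a i and g i is then realized from u' to v and split at v'.\<close>
      have ag: "a i \<otimes>\<^bsub>?A\<^esub> g i \<in> carrier ?A" "(u', v) \<in> signature R Q l (a i \<otimes>\<^bsub>?A\<^esub> g i)"
        using free_algebra_mult_closed[OF assms(1) c(1,2)]
          signature_mult[OF assms(1) Q c(1,2) s(2,3)] by auto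
      let ?y = "realization R Q l M \<phi> u u' (b i) x"
      have y: "?y \<in> carrier (M u')" by (rule realization_closed[OF Q rep s(1) x c(3)])
      have "realization R Q l M \<phi> u v (?h i) x = realization R Q l M \<phi> u' v (a i \<otimes>\<^bsub>?A\<^esub> g i) ?y"
        by (rule realization_mult[OF Q rep con ag(1) c(3) s(1) ag(2) x])
      also have "\<dots> = realization R Q l M \<phi> v' v (a i) (realization R Q l M \<phi> u' v' (g i) ?y)"
        by (rule realization_mult[OF Q rep con c(1,2) s(2,3) y])
      \<comment> \<open>The hypothesis on F applies because \<open>?y\<close> lies in the module at
        u', the source of this realization.\<close>
      also have "realization R Q l M \<phi> u' v' (g i) ?y = \<zero>\<^bsub>M v'\<^esub>"
        using zero[of "g i"] gab[OF i] s(2) y unfolding all_realizations_zero_def by fast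
      also have "realization R Q l M \<phi> v' v (a i) \<zero>\<^bsub>M v'\<^esub> = \<zero>\<^bsub>M v\<^esub>"
        by (rule realization_at_zero[OF Q rep s(3) c(1)])
      finally show ?thesis
        using free_algebra_mult_closed[OF assms(1) ag(1) c(3)]
          signature_mult[OF assms(1) Q ag(1) c(3) s(1) ag(2)] by simp
    qed
    \<comment> \<open>Additivity is available since (u, v) lies in the signature of every summand.
      For n = 0 both sides are zero.\<close>
    have "realization R Q l M \<phi> u v f x = (\<Oplus>\<^bsub>M v\<^esub>i\<in>{1..n}. realization R Q l M \<phi> u v (?h i) x)"
      unfolding f by (rule realization_finsum(2)[OF Q rep assms(1) verts x]) (use summand in auto)
    also have "\<dots> = \<zero>\<^bsub>M v\<^esub>" by (rule N.add.finprod_one_eqI) (use summand in auto)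
    finally show ?thesis .
  qed
  then show "all_realizations_zero R Q l M \<phi> f" by (auto simp: all_realizations_zero_def)
qed

end
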